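(* Let $G$ be a cubic $3$-edge-connected graph that has a set of six perfect matchings such that every edge of $G$ is contained in exactly two of them. Then $f(G)\leq 5$.
   Context: Graphs are finite and undirected; parallel edges are allowed. A graph is cubic if every vertex has degree $3$; it is $k$-edge-connected if at least $k$ edges leave every nonempty proper vertex subset. An orientation of $G$ replaces each edge $uv$ by exactly one of the arcs $uv$ or $vu$; for an edge $e$, $\vec e$ denotes the corresponding arc. A digraph is strongly connected if for every nonempty proper vertex subset $X$ some arc leaves $X$. For a $3$-edge-connected graph $G$, the Frank number $f(G)$ is the minimum integer $k$ such that there exist $k$ orientations $D_1,\dots,D_k$ of $G$ with the property that for every edge $e$ of $G$ there is an $i$ with $D_i-\vec e$ strongly connected. *)

theory Defs
  imports "Graph_Theory.Digraph_Component" "HOL-Library.Extended_Nat"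
begin

section \<open>Undirected multigraphs\<close>

text \<open>
  Edges are named objects mapped to their two-element set of end vertices, so parallel
  edges are distinct edges with equal \<open>ends\<close>. Loops are excluded; with a loop
  counting twice towards the degree, a cubic 3-edge-connected graph has none anyway.
\<close>

record ('v, 'e) multigraph =
  nodes :: "'v set"
  edges :: "'e set"
  ends :: "'e \<Rightarrow> 'v set"

definition fin_multigraph :: "('v, 'e) multigraph \<Rightarrow> bool" where
  "fin_multigraph G \<longleftrightarrow> finite (nodes G) \<and> finite (edges G) \<and>
     (\<forall>e\<in>edges G. ends G e \<subseteq> nodes G \<and> card (ends G e) = 2)"

definition degree :: "('v, 'e) multigraph \<Rightarrow> 'v \<Rightarrow> nat" where
  "degree G v = card {e \<in> edges G. v \<in> ends G e}"

definition cubic :: "('v, 'e) multigraph \<Rightarrow> bool" where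
  "cubic G \<longleftrightarrow> (\<forall>v\<in>nodes G. degree G v = 3)"

definition edge_cut :: "('v, 'e) multigraph \<Rightarrow> 'v set \<Rightarrow> 'e set" where
  "edge_cut G X = {e \<in> edges G. ends G e \<inter> X \<noteq> {} \<and> ends G e - X \<noteq> {}}"

definition edge_connected :: "nat \<Rightarrow> ('v, 'e) multigraph \<Rightarrow> bool" where
  "edge_connected k G \<longleftrightarrow>
     (\<forall>X. X \<noteq> {} \<and> X \<subset> nodes G \<longrightarrow> k \<le> card (edge_cut G X))"

definition perfect_matching :: "('v, 'e) multigraph \<Rightarrow> 'e set \<Rightarrow> bool" where
  "perfect_matching G M \<longleftrightarrow> M \<subseteq> edges G \<and> (\<forall>v\<in>nodes G. \<exists>!e. e \<in> M \<and> v \<in> ends G e)"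


section \<open>Orientations and strong connectivity\<close>

text \<open>
  The arc that replaces an edge \<open>e\<close> is again named \<open>e\<close>. So \<open>pre_digraph.del_arc D e\<close>
  deletes precisely this arc, and keeps the arcs of edges parallel to \<open>e\<close>.
\<close>

definition orientation_of ::
  "('v, 'e) multigraph \<Rightarrow> ('v, 'e) pre_digraph \<Rightarrow> bool" where
  "orientation_of G D \<longleftrightarrow> verts D = nodes G \<and> arcs D = edges G \<and>
     (\<forall>e\<in>edges G. ends G e = {tail D e, head D e})"

definition cut_strong :: "('v, 'e) pre_digraph \<Rightarrow> bool" where
  "cut_strong D \<longleftrightarrow>
     (\<forall>X. X \<noteq> {} \<and> X \<subset> verts D \<longrightarrow>
       (\<exists>a\<in>arcs D. tail D a \<in> X \<and> head D a \<in> verts D - X))"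

text \<open>The cut condition agrees with strong connectivity defined by reachability.\<close>

lemma (in wf_digraph) cut_strong_iff_strongly_connected:
  assumes "verts G \<noteq> {}"
  shows "cut_strong G \<longleftrightarrow> strongly_connected G"
proof
  assume cut: "cut_strong G"
  have "u \<rightarrow>\<^sup>* v" if u: "u \<in> verts G" and v: "v \<in> verts G" for u v
  proof (rule ccontr)
    assume nreach: "\<not> u \<rightarrow>\<^sup>* v"
    let ?X = "{w \<in> verts G. u \<rightarrow>\<^sup>* w}"
    have "?X \<noteq> {} \<and> ?X \<subset> verts G" using u v nreach by auto
    then obtain a where a: "a \<in> arcs G" "tail G a \<in> ?X" "head G a \<in> verts G - ?X"
      using cut unfolding cut_strong_def by meson
    then have "u \<rightarrow>\<^sup>* head G a"
      using reachable_adj_trans[of u "tail G a" "head G a"] by (auto simp: arcs_ends_conv)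
    then show False using a by auto
  qed
  then show "strongly_connected G" using assms by (simp add: strongly_connected_def)
next
  assume sc: "strongly_connected G"
  show "cut_strong G" unfolding cut_strong_def
  proof (intro allI impI)
    fix X assume X: "X \<noteq> {} \<and> X \<subset> verts G"
    then obtain u v where u: "u \<in> X" and v: "v \<in> verts G - X" by blast
    have "u \<rightarrow>\<^sup>* v" using sc X u v unfolding strongly_connected_def by blast
    then have "v \<in> X \<or> (\<exists>a\<in>arcs G. tail G a \<in> X \<and> head G a \<in> verts G - X)"
      by (induct rule: reachable_induct) (use u in \<open>auto simp: arcs_ends_conv\<close>)
    then show "\<exists>a\<in>arcs G. tail G a \<in> X \<and> head G a \<in> verts G - X" using v by blast
  qed
qed


section \<open>Frank number\<close>

definition deletable_by_orientations :: "('v, 'e) multigraph \<Rightarrow> nat \<Rightarrow> bool" where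
  "deletable_by_orientations G k \<longleftrightarrow>
     (\<exists>D :: nat \<Rightarrow> ('v, 'e) pre_digraph.
        (\<forall>i\<in>{1..k}. orientation_of G (D i)) \<and>
        (\<forall>e\<in>edges G. \<exists>i\<in>{1..k}. cut_strong (pre_digraph.del_arc (D i) e)))"

text \<open>
  The minimum is taken in \<^typ>\<open>enat\<close>, where the infimum of the empty set is \<open>\<infinity>\<close>:
  a finite upper bound on the Frank number entails that suitable orientations exist.
\<close>

definition frank_number :: "('v, 'e) multigraph \<Rightarrow> enat" where
  "frank_number G = Inf {enat k | k. deletable_by_orientations G k}"

end

theory Submission
  imports Defs
begin

text \<open>
  For \<open>i \<le> 5\<close> we choose an orientation in which every edge of \<open>M\<^sub>i\<close> outside one other matching
  \<open>M\<^sub>a\<close> is deletable; taking \<open>a\<close> to be the cyclic successor of \<open>i\<close> in \<open>{1..5}\<close>, these five sets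
  cover all edges. Let \<open>b, c, d, e\<close> be the remaining indices. Even subgraphs have balanced
  orientations, and we use such orientations of the complement of \<open>M\<^sub>i\<close> for the edges outside
  \<open>M\<^sub>i\<close>, of \<open>M\<^sub>a \<triangle> M\<^sub>b\<close> and \<open>M\<^sub>c \<triangle> M\<^sub>d\<close> for the edges of \<open>M\<^sub>i\<close> in these sets, and of
  \<open>M\<^sub>e \<triangle> M\<^sub>a\<close> for those in \<open>M\<^sub>e\<close>. A cut with an edge outside \<open>M\<^sub>i\<close> is crossed both ways by
  edges outside \<open>M\<^sub>i\<close>. In a cut inside \<open>M\<^sub>i\<close> the five other matchings partition the edges, each
  into a part of the same parity as the cut, and the balance conditions and the size
  of at least 3 show that some edge leaves it, and that a unique leaving edge lies in \<open>M\<^sub>a\<close>.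
\<close>

section \<open>Balanced orientations of graphs with all degrees even\<close>

text \<open>Induction on the number of edges by splitting off: shortcutting two edges at a common
  vertex keeps all parities, and an orientation of the smaller graph lifts by directing both edges
  along the shortcut. Because splitting changes ends, the incidence map \<open>g\<close> is
  arbitrary. Comparing tails and heads in every \<open>X\<close> is the equality of in-degree and
  out-degree summed over \<open>X\<close>, the form that cuts need.\<close>

lemma eulerian_orientation_exists:
  fixes g :: "'e \<Rightarrow> 'v set"
  assumes "finite S" "\<And>x. x \<in> S \<Longrightarrow> card (g x) = 2"
    and "\<And>v. even (\<Sum>x\<in>S. of_bool (v \<in> g x) :: nat)"
  shows "\<exists>t h. (\<forall>x\<in>S. g x = {t x, h x}) \<and>
    (\<forall>X. (\<Sum>x\<in>S. of_bool (t x \<in> X) :: nat) = (\<Sum>x\<in>S. of_bool (h x \<in> X)))"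
  using assms
proof (induct "card S" arbitrary: S g rule: less_induct)
  case less
  show ?case
  proof (cases "S = {}")
    case True
    then show ?thesis by simp
  next
    case False
    then obtain p where p: "p \<in> S" by blast
    then obtain u v where uv: "g p = {u, v}" "u \<noteq> v"
      using less.prems(2) by (meson card_2_iff)
    \<comment> \<open>Two edges \<open>uv\<close> and \<open>vw\<close> are replaced by one edge \<open>uw\<close>, or dropped if \<open>u = w\<close>.\<close>
    have "\<exists>q\<in>S - {p}. v \<in> g q"
    proof (rule ccontr)
      assume "\<not> ?thesis"
      then have "(\<Sum>x\<in>S - {p}. of_bool (v \<in> g x) :: nat) = 0" by simp
      then have "(\<Sum>x\<in>S. of_bool (v \<in> g x) :: nat) = 1"
        using sum.remove[OF less.prems(1) p, of "\<lambda>x. of_bool (v \<in> g x) :: nat"] uv by simp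
      then show False using less.prems(3)[of v] by simp
    qed
    then obtain q where q: "q \<in> S" "q \<noteq> p" "v \<in> g q" by blast
    then obtain w where w: "g q = {v, w}" "w \<noteq> v"
      using less.prems(2)[OF q(1)] by (auto simp: card_2_iff doubleton_eq_iff)
    define R where "R = S - {p, q}"
    have S: "S = insert p (insert q R)" and R: "finite R" "p \<notin> R" "q \<notin> R" "p \<noteq> q"
      using p q less.prems(1) by (auto simp: R_def)
    have upd: "(\<Sum>x\<in>S. of_bool ((f(p := y, q := z)) x \<in> X) :: nat)
        = (\<Sum>x\<in>R. of_bool (f x \<in> X)) + of_bool (y \<in> X) + of_bool (z \<in> X)"
      for f :: "'e \<Rightarrow> 'v" and y z X
    proof -
      have "(\<Sum>x\<in>R. of_bool ((f(p := y, q := z)) x \<in> X) :: nat) = (\<Sum>x\<in>R. of_bool (f x \<in> X))"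
        using R by (intro sum.cong) auto
      then show ?thesis using R unfolding S by (simp del: sum_of_bool_eq fun_upd_apply) simp
    qed
    have upd': "(\<Sum>x\<in>R. of_bool (z \<in> (g(p := Y)) x) :: nat) = (\<Sum>x\<in>R. of_bool (z \<in> g x))" for Y z
      using R by (intro sum.cong) auto
    \<comment> \<open>Lifting from \<open>R\<close> to \<open>S\<close>: \<open>y\<close> and
      \<open>z\<close> are the tails, \<open>y'\<close> and \<open>z'\<close> the heads given to
      \<open>p\<close> and \<open>q\<close>.\<close>
    have ext: ?thesis
      if th: "\<forall>x\<in>R. g x = {t x, h x}" and
        ends: "{y, y'} = {u, v}" "{z, z'} = {v, w}" and
        bal: "\<And>X. (\<Sum>x\<in>R. of_bool (t x \<in> X) :: nat) + of_bool (y \<in> X) + of_bool (z \<in> X)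
          = (\<Sum>x\<in>R. of_bool (h x \<in> X)) + of_bool (y' \<in> X) + of_bool (z' \<in> X)"
      for t h y y' z z'
    proof (intro exI conjI)
      show "\<forall>x\<in>S. g x = {(t(p := y, q := z)) x, (h(p := y', q := z')) x}"
        using th ends uv w R unfolding S by auto
      show "\<forall>X. (\<Sum>x\<in>S. of_bool ((t(p := y, q := z)) x \<in> X) :: nat)
          = (\<Sum>x\<in>S. of_bool ((h(p := y', q := z')) x \<in> X))"
      proof
        fix X
        show "(\<Sum>x\<in>S. of_bool ((t(p := y, q := z)) x \<in> X) :: nat)
          = (\<Sum>x\<in>S. of_bool ((h(p := y', q := z')) x \<in> X))"
          unfolding upd by (rule bal)
      qed
    qed
    show ?thesis
    proof (cases "u = w")
      case True
      have "even (\<Sum>x\<in>R. of_bool (z \<in> g x) :: nat)" for z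
        using less.prems(3)[of z] R uv w True unfolding S
        by (cases "z = v"; cases "z = w") (simp_all del: sum_of_bool_eq)
      moreover have "card R < card S" unfolding S using R by simp
      ultimately obtain t h where "\<forall>x\<in>R. g x = {t x, h x}"
        "\<forall>X. (\<Sum>x\<in>R. of_bool (t x \<in> X) :: nat) = (\<Sum>x\<in>R. of_bool (h x \<in> X))"
        using less.hyps[of R g] less.prems(2) R unfolding S by blast
      then show ?thesis using ext[of t h u v v u] True by auto
    next
      case False
      \<comment> \<open>The name \<open>p\<close> is reused for the shortcut \<open>uw\<close>, so
        no fresh edge name is required.\<close>
      let ?g = "g(p := {u, w})"
      have "even (\<Sum>x\<in>insert p R. of_bool (z \<in> ?g x) :: nat)" for z
        using less.prems(3)[of z] R uv w False unfolding S
        by (simp add: upd' del: fun_upd_apply sum_of_bool_eq) (auto split: if_splits simp del: sum_of_bool_eq)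
      moreover have "card (insert p R) < card S" unfolding S using R by simp
      moreover have "card (?g x) = 2" if "x \<in> insert p R" for x
        using that less.prems(2)[of x] False unfolding S by auto
      ultimately obtain t h where th: "\<forall>x\<in>insert p R. ?g x = {t x, h x}"
        and bal: "\<forall>X. (\<Sum>x\<in>insert p R. of_bool (t x \<in> X) :: nat) = (\<Sum>x\<in>insert p R. of_bool (h x \<in> X))"
        using less.hyps[of "insert p R" ?g] R by blast
      have th': "\<forall>x\<in>R. g x = {t x, h x}" using th R by (metis fun_upd_apply insertCI)
      have bal': "of_bool (t p \<in> X) + (\<Sum>x\<in>R. of_bool (t x \<in> X) :: nat)
          = of_bool (h p \<in> X) + (\<Sum>x\<in>R. of_bool (h x \<in> X))" for X
        using bal[rule_format, of X] R by (simp del: sum_of_bool_eq)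
      have "{t p, h p} = {u, w}" using th by simp
      \<comment> \<open>The path through \<open>v\<close> follows the direction of the shortcut. As
        \<open>v\<close> is the head of one edge and the tail of the other, it cancels in the
        balance.\<close>
      then consider "t p = u" "h p = w" | "t p = w" "h p = u" by (auto simp: doubleton_eq_iff)
      then show ?thesis
      proof cases
        case 1
        then show ?thesis using ext[of t h u v v w] th' bal' by (simp del: sum_of_bool_eq add: ac_simps)
      next
        case 2
        then show ?thesis using ext[of t h v u w v] th' bal' by (simp del: sum_of_bool_eq add: ac_simps insert_commute)
      qed
    qed
  qed
qed

section \<open>Cuts of even subgraphs\<close>

text \<open>Tails and heads are separate arguments so that exchanging them gives the arcs entering
  \<open>X\<close>.\<close>

definition out_cut :: "('e \<Rightarrow> 'v) \<Rightarrow> ('e \<Rightarrow> 'v) \<Rightarrow> 'e set \<Rightarrow> 'v set \<Rightarrow> 'e set" where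
  "out_cut t h S X = {x \<in> S. t x \<in> X \<and> h x \<notin> X}"

text \<open>Arcs with both ends in \<open>X\<close> contribute equally to the two sums; cancelling
  them leaves the two cut counts.\<close>

lemma out_cut_balanced:
  assumes "finite S"
    and "(\<Sum>x\<in>S. of_bool (t x \<in> X) :: nat) = (\<Sum>x\<in>S. of_bool (h x \<in> X))"
  shows "card (out_cut t h S X) = card (out_cut h t S X)"
proof -
  have split: "(\<Sum>x\<in>S. of_bool (f x \<in> X) :: nat)
      = card (out_cut f f' S X) + card {x \<in> S. f x \<in> X \<and> f' x \<in> X}" for f f' :: "'a \<Rightarrow> 'b"
  proof -
    have "(\<Sum>x\<in>S. of_bool (f x \<in> X) :: nat) = card {x \<in> S. f x \<in> X}"
      using assms(1) by (simp add: sum.If_cases of_bool_def Int_def)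
    also have "{x \<in> S. f x \<in> X} = out_cut f f' S X \<union> {x \<in> S. f x \<in> X \<and> f' x \<in> X}"
      by (auto simp: out_cut_def)
    also have "card \<dots> = card (out_cut f f' S X) + card {x \<in> S. f x \<in> X \<and> f' x \<in> X}"
      by (rule card_Un_disjoint) (use assms(1) in \<open>auto simp: out_cut_def\<close>)
    finally show ?thesis .
  qed
  have "{x \<in> S. h x \<in> X \<and> t x \<in> X} = {x \<in> S. t x \<in> X \<and> h x \<in> X}" by blast
  then show ?thesis using split[of t h] split[of h t] assms(2) by simp
qed

lemma balanced_orientation:
  assumes "fin_multigraph G" "S \<subseteq> edges G"
    and "\<And>v. v \<in> nodes G \<Longrightarrow> even (card {x \<in> S. v \<in> ends G x})"
  obtains t h where "\<And>x. x \<in> S \<Longrightarrow> ends G x = {t x, h x}"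
    and "\<And>X. card (out_cut t h S X) = card (out_cut h t S X)"
proof -
  have fin: "finite S" using assms(1,2) by (auto simp: fin_multigraph_def intro: finite_subset)
  have "even (\<Sum>x\<in>S. of_bool (v \<in> ends G x) :: nat)" for v
  proof (cases "v \<in> nodes G")
    case True
    then show ?thesis
      using assms(3) fin by (simp add: sum.If_cases of_bool_def Int_def)
  next
    case False
    then have "v \<notin> ends G x" if "x \<in> S" for x
      using that assms(1,2) by (auto simp: fin_multigraph_def)
    then have "(\<Sum>x\<in>S. of_bool (v \<in> ends G x) :: nat) = 0" by simp
    then show ?thesis by simp
  qed
  moreover have "card (ends G x) = 2" if "x \<in> S" for x
    using that assms(1,2) by (auto simp: fin_multigraph_def)
  ultimately obtain t h where "\<forall>x\<in>S. ends G x = {t x, h x}"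
    "\<forall>X. (\<Sum>x\<in>S. of_bool (t x \<in> X) :: nat) = (\<Sum>x\<in>S. of_bool (h x \<in> X))"
    using eulerian_orientation_exists[of S "ends G"] fin by blast
  then show thesis using that out_cut_balanced[OF fin] by blast
qed

lemma out_cut_edge_cut:
  assumes "S \<subseteq> edges G" "\<And>x. x \<in> S \<Longrightarrow> ends G x = {t x, h x}"
  shows "S \<inter> edge_cut G X = out_cut t h S X \<union> out_cut h t S X"
  using assms by (fastforce simp: edge_cut_def out_cut_def)

text \<open>In a balanced orientation as many edges leave \<open>X\<close> as enter it, so the cut
  count is twice either number.\<close>

lemma even_degree_cut:
  assumes "fin_multigraph G" "S \<subseteq> edges G"
    and "\<And>v. v \<in> nodes G \<Longrightarrow> even (card {x \<in> S. v \<in> ends G x})"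
  shows "even (card (S \<inter> edge_cut G X))"
proof -
  obtain t h where th: "\<And>x. x \<in> S \<Longrightarrow> ends G x = {t x, h x}"
    "\<And>X. card (out_cut t h S X) = card (out_cut h t S X)"
    using balanced_orientation[OF assms] by blast
  have "finite S" using assms(1,2) by (auto simp: fin_multigraph_def intro: finite_subset)
  then have "card (S \<inter> edge_cut G X) = card (out_cut t h S X) + card (out_cut h t S X)"
    unfolding out_cut_edge_cut[OF assms(2) th(1), simplified]
    by (intro card_Un_disjoint) (auto simp: out_cut_def)
  then show ?thesis using th(2) by simp
qed

section \<open>Even subgraphs from perfect matchings\<close>

lemma perfect_matching_incident:
  assumes "perfect_matching G M" "v \<in> nodes G"
  obtains p where "{x \<in> M. v \<in> ends G x} = {p}"
  using assms unfolding perfect_matching_def Ex1_def by blast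

text \<open>Each matching has a single edge at \<open>v\<close>: the two coincide and cancel, or
  they differ and both survive.\<close>

lemma perfect_matching_sym_diff_even:
  assumes "perfect_matching G M" "perfect_matching G N" "v \<in> nodes G"
  shows "even (card {x \<in> sym_diff M N. v \<in> ends G x})"
proof -
  obtain p q where "{x \<in> M. v \<in> ends G x} = {p}" "{x \<in> N. v \<in> ends G x} = {q}"
    using perfect_matching_incident assms by metis
  moreover have "{x \<in> sym_diff M N. v \<in> ends G x}
      = sym_diff {x \<in> M. v \<in> ends G x} {x \<in> N. v \<in> ends G x}" by blast
  ultimately have "{x \<in> sym_diff M N. v \<in> ends G x} = sym_diff {p} {q}" by simp
  moreover have "even (card (sym_diff {p} {q}))"
    by (cases "p = q") (simp_all add: insert_Diff_if)
  ultimately show ?thesis by (simp only:)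
qed

lemma perfect_matching_complement_even:
  assumes "fin_multigraph G" "cubic G" "perfect_matching G M" "v \<in> nodes G"
  shows "even (card {x \<in> edges G - M. v \<in> ends G x})"
proof -
  obtain p where p: "{x \<in> M. v \<in> ends G x} = {p}"
    using perfect_matching_incident assms(3,4) by metis
  have "{x \<in> edges G - M. v \<in> ends G x} = {x \<in> edges G. v \<in> ends G x} - {x \<in> M. v \<in> ends G x}"
    by blast
  moreover have "{x \<in> M. v \<in> ends G x} \<subseteq> {x \<in> edges G. v \<in> ends G x}"
    using assms(3) by (auto simp: perfect_matching_def)
  moreover have "card {x \<in> edges G. v \<in> ends G x} = 3"
    using assms(2,4) by (simp add: cubic_def degree_def)
  ultimately show ?thesis unfolding p by simp
qed

text \<open>
  Here \<open>kO\<close> and \<open>kI\<close> count the edges of matching \<open>k\<close> that leave and enter a cut, and \<open>p\<close>, \<open>q\<close>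
  are the corresponding numbers for \<open>a\<close> in the orientation that balances \<open>e\<close> against \<open>a\<close>.
\<close>

lemma no_thin_cut:
  fixes aO aI bO bI cO cI dO dI eO eI p q n :: nat
  assumes "aO = 0" "aO + bO = aI + bI" "cO + dO = cI + dI" "eO + p = eI + q" "p + q = aO + aI"
    and "aO + bO + cO + dO + eO \<le> 1" "3 \<le> n"
    and n: "n = aO + bO + cO + dO + eO + (aI + bI + cI + dI + eI)"
    and par: "even (n + (cO + cI))"
  shows False
proof -
  \<comment> \<open>The cases say where the leaving edge, if any, can lie. In the first two the
    balance equations leave at most two edges in the cut.\<close>
  consider "bO = 0" "cO + dO = 0" | "bO = 0" "cO + dO = 1" "eO = 0" | "bO = 1" "cO + dO = 0" "eO = 0"
    using assms(6) by linarith
  then show False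
  proof cases
    case 1
    then have "aI = 0" "p = 0" "q = 0" "cI = 0" "dI = 0" "bI = 0" "eI = eO" "eO \<le> 1"
      using assms(1-6) by auto
    then show False using 1 assms(1,7,8) by simp
  next
    case 2
    then have "aI = 0" "p = 0" "q = 0" "bI = 0" "eI = 0"
      using assms(1-5) by auto
    then show False using 2 assms(1,3,7,8) by simp
  next
    \<comment> \<open>Here the balance still permits three edges, with \<open>aI = eI = 1\<close>.
      Then \<open>n\<close> is odd while \<open>c\<close> has no edge in the cut, against
      \<open>par\<close>.\<close>
    case 3
    then have "cI = 0" "dI = 0" "aI + bI = 1" "eI + q = p" "p + q = aI"
      using assms(1-5) by auto
    then show False using 3 assms(1,7,8) par by (cases "eI = 1") auto
  qed
qed

section \<open>The orientation for one ordered pair of matchings\<close>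

text \<open>\<open>idx\<close> assigns the roles of the six matchings; the conclusion mentions only
  \<open>i\<close> and \<open>a\<close>, so the other four may be listed in any order.\<close>

lemma orientation_star:
  fixes G :: "('v, 'e) multigraph" and M :: "nat \<Rightarrow> 'e set"
  assumes fin: "fin_multigraph G" and "cubic G" and conn: "edge_connected 3 G"
    and pm: "\<forall>k\<in>{1..6}. perfect_matching G (M k)"
    and two: "\<forall>x\<in>edges G. card {k \<in> {1..6}. x \<in> M k} = 2"
    and idx: "{1..6} = {i, a, b, c, d, e}"
  shows "\<exists>D. orientation_of G D \<and> (\<forall>x\<in>M i - M a. cut_strong (pre_digraph.del_arc D x))"
proof -
  have "card (set [i, a, b, c, d, e]) = 6"
    unfolding list.set idx[symmetric] by simp
  moreover have "length [i, a, b, c, d, e] = 6" by simp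
  ultimately have dist: "distinct [i, a, b, c, d, e]"
    by (intro card_distinct) (simp only:)
  have pmk: "perfect_matching G (M k)" if "k \<in> {i, a, b, c, d, e}" for k
    using pm that unfolding idx by blast
  have sub: "M k \<subseteq> edges G" if "k \<in> {i, a, b, c, d, e}" for k
    using pmk[OF that] by (simp add: perfect_matching_def)
  have partner: "\<exists>j\<in>{a, b, c, d, e}. \<forall>k\<in>{a, b, c, d, e}. x \<in> M k \<longleftrightarrow> k = j" if "x \<in> M i" for x
  proof -
    have xi: "i \<in> {k \<in> {1..6}. x \<in> M k}" using that idx by blast
    have "card {k \<in> {1..6}. x \<in> M k} = 2" using two sub[of i] that by blast
    then have "card ({k \<in> {1..6}. x \<in> M k} - {i}) = 1" using xi by simp
    then obtain j where "{k \<in> {1..6}. x \<in> M k} - {i} = {j}" by (auto simp: card_1_singleton_iff)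
    moreover have "{1..6} - {i} = {a, b, c, d, e}"
      unfolding idx using dist by simp
    ultimately show ?thesis by blast
  qed
  note bal = balanced_orientation[OF fin]
  have symd: "sym_diff (M k) (M l) \<subseteq> edges G" if "k \<in> {i, a, b, c, d, e}" "l \<in> {i, a, b, c, d, e}" for k l
    using sub that by blast
  have symd_even: "even (card {x \<in> sym_diff (M k) (M l). v \<in> ends G x})"
    if "k \<in> {i, a, b, c, d, e}" "l \<in> {i, a, b, c, d, e}" "v \<in> nodes G" for k l v
    using perfect_matching_sym_diff_even[OF pmk[OF that(1)] pmk[OF that(2)] that(3)] .
  obtain t1 h1 where o1: "\<And>x. x \<in> edges G - M i \<Longrightarrow> ends G x = {t1 x, h1 x}"
    "\<And>X. card (out_cut t1 h1 (edges G - M i) X) = card (out_cut h1 t1 (edges G - M i) X)"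
    using bal[of "edges G - M i"] perfect_matching_complement_even[OF fin assms(2) pmk[of i]] by blast
  obtain t2 h2 where o2: "\<And>x. x \<in> sym_diff (M a) (M b) \<Longrightarrow> ends G x = {t2 x, h2 x}"
    "\<And>X. card (out_cut t2 h2 (sym_diff (M a) (M b)) X) = card (out_cut h2 t2 (sym_diff (M a) (M b)) X)"
    using bal[OF symd[of a b] symd_even[of a b]] by blast
  obtain t3 h3 where o3: "\<And>x. x \<in> sym_diff (M c) (M d) \<Longrightarrow> ends G x = {t3 x, h3 x}"
    "\<And>X. card (out_cut t3 h3 (sym_diff (M c) (M d)) X) = card (out_cut h3 t3 (sym_diff (M c) (M d)) X)"
    using bal[OF symd[of c d] symd_even[of c d]] by blast
  \<comment> \<open>Five matchings cannot be paired off, so \<open>M e\<close> is balanced against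
    the already used \<open>M a\<close>. On \<open>M i \<inter> M a\<close> this orientation serves
    only for counting, since \<open>t\<close> and \<open>h\<close> follow \<open>t2\<close> and
    \<open>h2\<close> there.\<close>
  obtain t4 h4 where o4: "\<And>x. x \<in> sym_diff (M e) (M a) \<Longrightarrow> ends G x = {t4 x, h4 x}"
    "\<And>X. card (out_cut t4 h4 (sym_diff (M e) (M a)) X) = card (out_cut h4 t4 (sym_diff (M e) (M a)) X)"
    using bal[OF symd[of e a] symd_even[of e a]] by blast
  \<comment> \<open>One selector serves tails and heads, so both ends of an edge come from the same
    orientation. Inside \<open>M i\<close> the last branch is reached exactly by the edges of
    \<open>M e\<close>.\<close>
  define pick where "pick f1 f2 f3 f4 x =
    (if x \<notin> M i then f1 x else if x \<in> M a \<union> M b then f2 x else if x \<in> M c \<union> M d then f3 x else f4 x)"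
    for f1 f2 f3 f4 :: "'e \<Rightarrow> 'v" and x
  define t where "t = pick t1 t2 t3 t4"
  define h where "h = pick h1 h2 h3 h4"
  have th: "ends G x = {t x, h x}" if "x \<in> edges G" for x
  proof (cases "x \<in> M i")
    case False
    then show ?thesis using that o1(1)[of x] by (simp add: t_def h_def pick_def)
  next
    case True
    obtain j where j: "j \<in> {a, b, c, d, e}" "\<And>k. k \<in> {a, b, c, d, e} \<Longrightarrow> x \<in> M k \<longleftrightarrow> k = j"
      using partner[OF True] by blast
    consider "j = a \<or> j = b" | "j = c \<or> j = d" | "j = e" using j(1) by blast
    then show ?thesis
    proof cases
      case 1
      then have "x \<in> sym_diff (M a) (M b)" using j(2)[of a] j(2)[of b] dist by auto
      then show ?thesis using o2(1)[of x] True by (auto simp: t_def h_def pick_def)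
    next
      case 2
      then have "x \<in> sym_diff (M c) (M d)" "x \<notin> M a \<union> M b"
        using j(2)[of a] j(2)[of b] j(2)[of c] j(2)[of d] dist by auto
      then show ?thesis using o3(1)[of x] True by (auto simp: t_def h_def pick_def)
    next
      case 3
      then have "x \<in> sym_diff (M e) (M a)" "x \<notin> M a \<union> M b" "x \<notin> M c \<union> M d"
        using j(2)[of a] j(2)[of b] j(2)[of c] j(2)[of d] j(2)[of e] dist by auto
      then show ?thesis using o4(1)[of x] True by (simp add: t_def h_def pick_def)
    qed
  qed
  define D where "D = \<lparr>verts = nodes G, arcs = edges G, tail = t, head = h\<rparr>"
  have "orientation_of G D" using th by (simp add: orientation_of_def D_def)
  moreover have "cut_strong (pre_digraph.del_arc D x)" if x: "x \<in> M i" "x \<notin> M a" for x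
  proof -
    have "\<exists>y\<in>edges G - {x}. t y \<in> X \<and> h y \<in> nodes G - X" if X: "X \<noteq> {}" "X \<subset> nodes G" for X
    proof (rule ccontr)
      assume neg: "\<not> ?thesis"
      define Lv where "Lv = out_cut t h (edges G) X"
      define En where "En = out_cut h t (edges G) X"
      define \<delta> where "\<delta> = edge_cut G X"
      have finE: "finite (edges G)" using fin by (simp add: fin_multigraph_def)
      have \<delta>: "\<delta> = Lv \<union> En" "Lv \<inter> En = {}"
        using out_cut_edge_cut[of "edges G" G t h X] th
        by (auto simp: \<delta>_def Lv_def En_def edge_cut_def out_cut_def)
      have fin\<delta>: "finite Lv" "finite En" "finite \<delta>" using finE \<delta> by (auto simp: Lv_def En_def out_cut_def)
      have Lx: "Lv \<subseteq> {x}"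
      proof
        fix y assume y: "y \<in> Lv"
        then have "h y \<in> nodes G" using th[of y] fin by (auto simp: Lv_def out_cut_def fin_multigraph_def)
        then show "y \<in> {x}" using y neg by (auto simp: Lv_def out_cut_def)
      qed
      have sel0: "t y = t1 y" "h y = h1 y" if "y \<notin> M i" for y
        using that by (simp_all add: t_def h_def pick_def)
      \<comment> \<open>No edge outside \<open>M i\<close> leaves \<open>X\<close>, so by balance
        none enters, and the whole cut lies in \<open>M i\<close>.\<close>
      have "out_cut t1 h1 (edges G - M i) X = Lv - M i" "out_cut h1 t1 (edges G - M i) X = En - M i"
        by (auto simp: Lv_def En_def out_cut_def sel0)
      then have "card (En - M i) = card (Lv - M i)" using o1(2)[of X] by simp
      moreover have "Lv - M i = {}" using Lx x by blast
      ultimately have "En - M i = {}" using fin\<delta> by simp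
      then have \<delta>M: "\<delta> \<subseteq> M i" using \<delta> Lx x by blast
      have ge3: "3 \<le> card \<delta>" using conn X by (simp add: edge_connected_def \<delta>_def)
      have split\<delta>: "card \<delta> = card Lv + card En" using \<delta> fin\<delta> by (simp add: card_Un_disjoint)
      have excl: "y \<in> M k \<Longrightarrow> y \<notin> M l" if "y \<in> \<delta>" "k \<in> {a, b, c, d, e}" "l \<in> {a, b, c, d, e}" "k \<noteq> l" for y k l
        using partner[OF subsetD[OF \<delta>M that(1)]] that(2-) by metis
      have cardk: "card (Y \<inter> M a) + card (Y \<inter> M b) + card (Y \<inter> M c) + card (Y \<inter> M d) + card (Y \<inter> M e) = card Y"
        if "Y \<subseteq> \<delta>" for Y
      proof -
        have "\<exists>k\<in>{a, b, c, d, e}. y \<in> M k" if "y \<in> Y" for y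
          using partner[of y] that \<open>Y \<subseteq> \<delta>\<close> \<delta>M by blast
        then have "Y = (\<Union>k\<in>{a, b, c, d, e}. Y \<inter> M k)" by blast
        moreover have "card (\<Union>k\<in>{a, b, c, d, e}. Y \<inter> M k) = (\<Sum>k\<in>{a, b, c, d, e}. card (Y \<inter> M k))"
        proof (rule card_UN_disjoint)
          show "\<forall>k\<in>{a, b, c, d, e}. \<forall>l\<in>{a, b, c, d, e}. k \<noteq> l \<longrightarrow> Y \<inter> M k \<inter> (Y \<inter> M l) = {}"
          proof (intro ballI impI)
            fix k l
            assume kl: "k \<in> {a, b, c, d, e}" "l \<in> {a, b, c, d, e}" "k \<noteq> l"
            show "Y \<inter> M k \<inter> (Y \<inter> M l) = {}" using excl[OF _ kl] that by blast
          qed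
        qed (use that fin\<delta> in \<open>auto intro: finite_subset\<close>)
        ultimately show ?thesis using dist by simp
      qed
      have splitk: "card (\<delta> \<inter> M k) = card (Lv \<inter> M k) + card (En \<inter> M k)" for k
        unfolding \<delta>(1) Int_Un_distrib2 using \<delta>(2) fin\<delta> by (intro card_Un_disjoint) auto
      \<comment> \<open>Since the cut lies in \<open>M i\<close>, the even subgraph
        \<open>sym_diff (M i) (M c)\<close> meets it in exactly the edges outside
        \<open>M c\<close>.\<close>
      have par: "even (card \<delta> + (card (Lv \<inter> M c) + card (En \<inter> M c)))"
      proof -
        have "sym_diff (M i) (M c) \<inter> \<delta> = \<delta> - \<delta> \<inter> M c" using \<delta>M by blast
        then have "even (card (\<delta> - \<delta> \<inter> M c))"
          using even_degree_cut[OF fin symd[of i c] symd_even[of i c], of X] unfolding \<delta>_def by auto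
        moreover have "card (\<delta> - \<delta> \<inter> M c) = card \<delta> - card (\<delta> \<inter> M c)" "card (\<delta> \<inter> M c) \<le> card \<delta>"
          using fin\<delta> by (auto simp: card_Diff_subset card_mono)
        ultimately show ?thesis unfolding splitk by presburger
      qed
      have sel: "t y = t2 y \<and> h y = h2 y" if "y \<in> \<delta>" "y \<in> M a \<union> M b" for y
        using that subsetD[OF \<delta>M that(1)] by (simp add: t_def h_def pick_def)
      have sel': "t y = t3 y \<and> h y = h3 y" if "y \<in> \<delta>" "y \<in> M c \<union> M d" for y
      proof -
        have "y \<notin> M a" "y \<notin> M b"
          using that(2) excl[OF that(1), of c a] excl[OF that(1), of c b]
            excl[OF that(1), of d a] excl[OF that(1), of d b] dist by auto
        then show ?thesis using that subsetD[OF \<delta>M that(1)] by (simp add: t_def h_def pick_def)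
      qed
      have sel'': "t y = t4 y \<and> h y = h4 y" if "y \<in> \<delta>" "y \<in> M e" for y
      proof -
        have "y \<notin> M a" "y \<notin> M b" "y \<notin> M c" "y \<notin> M d"
          using that(2) excl[OF that(1), of e a] excl[OF that(1), of e b]
            excl[OF that(1), of e c] excl[OF that(1), of e d] dist by auto
        then show ?thesis using subsetD[OF \<delta>M that(1)] by (simp add: t_def h_def pick_def)
      qed
      have in_cut: "S \<inter> \<delta> = out_cut f g S X \<union> out_cut g f S X"
        if "S \<subseteq> edges G" "\<And>y. y \<in> S \<Longrightarrow> ends G y = {f y, g y}" for S f g
        using out_cut_edge_cut[OF that] by (simp add: \<delta>_def)
      have sum2: "card ((Y \<inter> M k) \<union> (Y' \<inter> M l)) = card (Y \<inter> M k) + card (Y' \<inter> M l)"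
        if "Y \<subseteq> \<delta>" "Y' \<subseteq> \<delta>" "k \<in> {a, b, c, d, e}" "l \<in> {a, b, c, d, e}" "k \<noteq> l" for Y Y' k l
      proof (rule card_Un_disjoint)
        show "Y \<inter> M k \<inter> (Y' \<inter> M l) = {}" using excl[OF _ that(3-5)] that(1) by blast
      qed (use that(1,2) fin\<delta> in \<open>auto intro: finite_subset\<close>)
      have memL: "y \<in> Lv \<longleftrightarrow> y \<in> \<delta> \<and> t y \<in> X \<and> h y \<notin> X" and memE: "y \<in> En \<longleftrightarrow> y \<in> \<delta> \<and> h y \<in> X \<and> t y \<notin> X" for y
        using \<delta>(1) by (auto simp: Lv_def En_def out_cut_def)
      \<comment> \<open>Matchings \<open>k\<close> and \<open>l\<close> are disjoint within the cut,
        so their symmetric difference contains all cut edges of both, and on these \<open>t\<close>,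
        \<open>h\<close> agree with \<open>f\<close>, \<open>g\<close>.\<close>
      have bal_pair: "card (Lv \<inter> M k) + card (Lv \<inter> M l) = card (En \<inter> M k) + card (En \<inter> M l)"
        if kl: "k \<in> {a, b, c, d, e}" "l \<in> {a, b, c, d, e}" "k \<noteq> l"
          and ends: "\<And>y. y \<in> sym_diff (M k) (M l) \<Longrightarrow> ends G y = {f y, g y}"
          and eul: "card (out_cut f g (sym_diff (M k) (M l)) X) = card (out_cut g f (sym_diff (M k) (M l)) X)"
          and sel: "\<And>y. y \<in> \<delta> \<Longrightarrow> y \<in> M k \<union> M l \<Longrightarrow> t y = f y \<and> h y = g y" for k l f g
      proof -
        have mem: "y \<in> \<delta>" if "y \<in> out_cut f g (sym_diff (M k) (M l)) X \<or> y \<in> out_cut g f (sym_diff (M k) (M l)) X" for y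
          using in_cut[OF symd[of k l] ends] kl that by blast
        have "out_cut f g (sym_diff (M k) (M l)) X = (Lv \<inter> M k) \<union> (Lv \<inter> M l)"
        proof (intro set_eqI iffI)
          fix y assume "y \<in> out_cut f g (sym_diff (M k) (M l)) X"
          then show "y \<in> (Lv \<inter> M k) \<union> (Lv \<inter> M l)"
            using mem[of y] sel[of y] by (auto simp: memL out_cut_def)
        next
          fix y assume "y \<in> (Lv \<inter> M k) \<union> (Lv \<inter> M l)"
          then show "y \<in> out_cut f g (sym_diff (M k) (M l)) X"
            using sel[of y] excl[of y, OF _ kl] by (auto simp: memL out_cut_def)
        qed
        moreover have "out_cut g f (sym_diff (M k) (M l)) X = (En \<inter> M k) \<union> (En \<inter> M l)"
        proof (intro set_eqI iffI)
          fix y assume "y \<in> out_cut g f (sym_diff (M k) (M l)) X"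
          then show "y \<in> (En \<inter> M k) \<union> (En \<inter> M l)"
            using mem[of y] sel[of y] by (auto simp: memE out_cut_def)
        next
          fix y assume "y \<in> (En \<inter> M k) \<union> (En \<inter> M l)"
          then show "y \<in> out_cut g f (sym_diff (M k) (M l)) X"
            using sel[of y] excl[of y, OF _ kl] by (auto simp: memE out_cut_def)
        qed
        ultimately show ?thesis
          using eul sum2[OF _ _ kl, of Lv Lv] sum2[OF _ _ kl, of En En] \<delta>(1) by simp
      qed
      have bal_ab: "card (Lv \<inter> M a) + card (Lv \<inter> M b) = card (En \<inter> M a) + card (En \<inter> M b)"
        by (rule bal_pair[OF _ _ _ o2 sel]) (use dist in auto)
      have bal_cd: "card (Lv \<inter> M c) + card (Lv \<inter> M d) = card (En \<inter> M c) + card (En \<inter> M d)"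
        by (rule bal_pair[OF _ _ _ o3 sel']) (use dist in auto)
      \<comment> \<open>\<open>p\<close> and \<open>q\<close> count the edges of
        \<open>\<delta> \<inter> M a\<close> leaving and entering under \<open>t4\<close>,
        \<open>h4\<close>. Their actual directions may differ, so only the sum \<open>p + q\<close>
        is tied to \<open>t\<close> and \<open>h\<close>.\<close>
      obtain p q where bal_e: "card (Lv \<inter> M e) + p = card (En \<inter> M e) + q" "p + q = card (\<delta> \<inter> M a)"
      proof -
        let ?O = "out_cut t4 h4 (sym_diff (M e) (M a)) X" and ?I = "out_cut h4 t4 (sym_diff (M e) (M a)) X"
        have cut: "sym_diff (M e) (M a) \<inter> \<delta> = ?O \<union> ?I" using in_cut[OF symd[of e a] o4(1)] by blast
        then have mem: "y \<in> \<delta>" if "y \<in> ?O \<or> y \<in> ?I" for y using that by blast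
        have ea: "y \<notin> M a" if "y \<in> \<delta>" "y \<in> M e" for y
          using excl[of y e a] that dist by auto
        have "?O = (Lv \<inter> M e) \<union> (?O \<inter> M a)"
        proof (intro set_eqI iffI)
          fix y assume "y \<in> ?O"
          then show "y \<in> (Lv \<inter> M e) \<union> (?O \<inter> M a)"
            using mem[of y] sel''[of y] by (auto simp: memL out_cut_def)
        next
          fix y assume "y \<in> (Lv \<inter> M e) \<union> (?O \<inter> M a)"
          then show "y \<in> ?O" using sel''[of y] ea[of y] by (auto simp: memL out_cut_def)
        qed
        moreover have "?I = (En \<inter> M e) \<union> (?I \<inter> M a)"
        proof (intro set_eqI iffI)
          fix y assume "y \<in> ?I"
          then show "y \<in> (En \<inter> M e) \<union> (?I \<inter> M a)"
            using mem[of y] sel''[of y] by (auto simp: memE out_cut_def)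
        next
          fix y assume "y \<in> (En \<inter> M e) \<union> (?I \<inter> M a)"
          then show "y \<in> ?I" using sel''[of y] ea[of y] by (auto simp: memE out_cut_def)
        qed
        moreover have "?O \<subseteq> \<delta>" "?I \<subseteq> \<delta>" using mem by blast+
        ultimately have eq: "card (Lv \<inter> M e) + card (?O \<inter> M a) = card (En \<inter> M e) + card (?I \<inter> M a)"
          using o4(2)[of X] sum2[of Lv ?O e a] sum2[of En ?I e a] \<delta>(1) dist by force
        have "\<delta> \<inter> M a = (?O \<inter> M a) \<union> (?I \<inter> M a)"
          using cut ea by blast
        moreover have "card ((?O \<inter> M a) \<union> (?I \<inter> M a)) = card (?O \<inter> M a) + card (?I \<inter> M a)"
          using mem fin\<delta> by (intro card_Un_disjoint) (auto simp: out_cut_def intro: finite_subset[of _ \<delta>])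
        ultimately show thesis using that eq by simp
      qed
      have "card Lv \<le> 1" using card_mono[OF _ Lx] by simp
      \<comment> \<open>This is where \<open>x \<notin> M a\<close> enters: no edge other than
        \<open>x\<close> can leave.\<close>
      moreover have a0: "card (Lv \<inter> M a) = 0" using Lx x by (auto simp: card_eq_0_iff)
      ultimately show False
        using no_thin_cut[OF a0 bal_ab bal_cd bal_e[unfolded splitk] _ ge3 _ par]
          cardk[of Lv] cardk[of En] \<delta>(1) split\<delta> by simp
    qed
    then show ?thesis
      by (simp add: cut_strong_def pre_digraph.del_arc_def D_def)
  qed
  ultimately show ?thesis by blast
qed

section \<open>Combining five orientations\<close>

theorem theorem15:
  fixes G :: "('v, 'e) multigraph" and M :: "nat \<Rightarrow> 'e set"
  assumes "fin_multigraph G"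
    and "cubic G"
    and "edge_connected 3 G"
    and "\<forall>i\<in>{1..6}. perfect_matching G (M i)"
    and "\<forall>e\<in>edges G. card {i \<in> {1..6}. e \<in> M i} = 2"
  shows "frank_number G \<le> 5"
proof -
  \<comment> \<open>The cycle runs through the first five indices only; \<open>6\<close> gets no
    orientation and is always one of the four remaining roles.\<close>
  define \<sigma> :: "nat \<Rightarrow> nat" where "\<sigma> i = (if i = 5 then 1 else i + 1)" for i
  have "\<exists>D. orientation_of G D \<and> (\<forall>x\<in>M i - M (\<sigma> i). cut_strong (pre_digraph.del_arc D x))"
    if "i \<in> {1..5}" for i
  proof -
    have "\<exists>b c d e. {1..6} = {i, \<sigma> i, b, c, d, e}"
    proof -
      have six: "{1..6::nat} = {1, 2, 3, 4, 5, 6}" by auto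
      have "i = 1 \<or> i = 2 \<or> i = 3 \<or> i = 4 \<or> i = 5" using that by auto
      then show ?thesis
      proof (elim disjE)
        assume "i = 1"
        then show ?thesis unfolding six \<sigma>_def
          by (intro exI[of _ 3] exI[of _ 4] exI[of _ 5] exI[of _ 6]) auto
      next
        assume "i = 2"
        then show ?thesis unfolding six \<sigma>_def
          by (intro exI[of _ 1] exI[of _ 4] exI[of _ 5] exI[of _ 6]) auto
      next
        assume "i = 3"
        then show ?thesis unfolding six \<sigma>_def
          by (intro exI[of _ 1] exI[of _ 2] exI[of _ 5] exI[of _ 6]) auto
      next
        assume "i = 4"
        then show ?thesis unfolding six \<sigma>_def
          by (intro exI[of _ 1] exI[of _ 2] exI[of _ 3] exI[of _ 6]) auto
      next
        assume "i = 5"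
        then show ?thesis unfolding six \<sigma>_def
          by (intro exI[of _ 2] exI[of _ 3] exI[of _ 4] exI[of _ 6]) auto
      qed
    qed
    then show ?thesis using orientation_star[OF assms] by blast
  qed
  then have "\<forall>i\<in>{1..5}. \<exists>D. orientation_of G D \<and>
      (\<forall>x\<in>M i - M (\<sigma> i). cut_strong (pre_digraph.del_arc D x))" by blast
  then obtain D where D: "\<forall>i\<in>{1..5}. orientation_of G (D i) \<and>
      (\<forall>x\<in>M i - M (\<sigma> i). cut_strong (pre_digraph.del_arc (D i) x))"
    by (auto dest: bchoice)
  \<comment> \<open>An uncovered edge in one of the first five matchings would pass along the cycle
    into all of them, too many for a double cover. An edge in none of them would lie at most in
    \<open>M 6\<close>, too few.\<close>
  have "\<exists>i\<in>{1..5}. x \<in> M i - M (\<sigma> i)" if x: "x \<in> edges G" for x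
  proof (rule ccontr)
    assume neg: "\<not> ?thesis"
    have step: "x \<in> M (\<sigma> i)" if "i \<in> {1..5}" "x \<in> M i" for i using neg that by blast
    have cyc: "x \<in> M 1 \<Longrightarrow> x \<in> M 2" "x \<in> M 2 \<Longrightarrow> x \<in> M 3" "x \<in> M 3 \<Longrightarrow> x \<in> M 4"
      "x \<in> M 4 \<Longrightarrow> x \<in> M 5" "x \<in> M 5 \<Longrightarrow> x \<in> M 1"
      using step[of 1] step[of 2] step[of 3] step[of 4] step[of 5] by (auto simp: \<sigma>_def numeral_eq_Suc)
    have two: "card {i \<in> {1..6}. x \<in> M i} = 2" using assms(5) x by blast
    show False
    proof (cases "x \<in> M 1")
      case True
      then have "{1, 2, 3} \<subseteq> {i \<in> {1..6}. x \<in> M i}" using cyc by auto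
      then have "card {1, 2, 3::nat} \<le> card {i \<in> {1..6}. x \<in> M i}" by (intro card_mono) auto
      then show False using two by simp
    next
      case False
      then have no: "x \<notin> M i" if "i \<in> {1, 2, 3, 4, 5}" for i using that cyc by auto
      have "{i \<in> {1..6}. x \<in> M i} \<subseteq> {6}"
      proof
        fix i assume i: "i \<in> {i \<in> {1..6}. x \<in> M i}"
        then have "i \<in> {1, 2, 3, 4, 5} \<or> i = 6" by auto
        then show "i \<in> {6}" using no[of i] i by blast
      qed
      then have "card {i \<in> {1..6}. x \<in> M i} \<le> card {6::nat}" by (intro card_mono) auto
      then show False using two by simp
    qed
  qed
  then have "\<forall>x\<in>edges G. \<exists>i\<in>{1..5}. cut_strong (pre_digraph.del_arc (D i) x)"
    using D by blast
  then have "deletable_by_orientations G 5"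
    unfolding deletable_by_orientations_def using D by blast
  then have "frank_number G \<le> enat 5" unfolding frank_number_def by (intro Inf_lower) blast
  then show ?thesis by (simp add: numeral_eq_enat)
qed

end
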